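(* Let $m\ge1$, let $B$ and $B'$ be two $m$-level rook equivalent Ferrers boards, and let $N$ be large enough that $B$ and $B'$ both fit inside $\mathrm{Sq}_{N,m}$. Then for any integer $0\le k\le N$, $h^{(m)}_{k,N}(B)=h^{(m)}_{k,N}(B')$.
   Context: Fix an integer $m\ge 1$. A Ferrers board with columns of heights $0\le b_1\le\dots\le b_n$ consists of bottom-justified columns of these heights, left to right. Level $p$ ($p\ge1$) consists of rows $(p-1)m+1,\dots,pm$, counted from the bottom. An $m$-level rook placement of $k$ rooks on a board is a set of $k$ of its cells, no two in the same column or the same level; $r_{k,m}(B)$ is the number of these on $B$; $B,B'$ are $m$-level rook equivalent if $r_{k,m}(B)=r_{k,m}(B')$ for all $k\ge0$. $\mathrm{Sq}_{N,m}$ is the rectangular board with $N$ columns and $mN$ rows. $B$ fits inside it if, on aligning the lower right cells, $B\subseteq \mathrm{Sq}_{N,m}$; $B$ is then so placed. For $\omega=(\alpha^{s_1},\dots,\alpha^{s_N};\sigma)\in C_m\wr S_N$ ($\alpha$ a generator of the cyclic group $C_m$, $1\le s_i\le m$, $\sigma\in S_N$), $R(\omega)$ is the placement on $\mathrm{Sq}_{N,m}$ with, for each $i$, a rook in column $i$, in level $N+1-\sigma(i)$, in the $s_i$-th cell from the bottom of that level. The $k$th hit set is $H^{(m)}_{k,N}(B)=\{R(\omega)\mid \omega\in C_m\wr S_N,\ \#(R(\omega)\cap B)=k\}$ and the $k$th hit number is $h^{(m)}_{k,N}(B)=\#H^{(m)}_{k,N}(B)$. *)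

theory Defs
  imports "HOL-Combinatorics.Permutations" "HOL-Library.FuncSet"
begin

text \<open>
  A cell is a pair (column, row). Rows are counted from the bottom, starting with 1.
  Columns are integers because aligning a board at its lower right cell may move
  empty leading columns to non-positive positions.
\<close>

type_synonym cell = "int \<times> nat"

definition ferrers_board :: "nat list \<Rightarrow> bool" where
  "ferrers_board b \<longleftrightarrow> sorted b"

definition cells :: "nat list \<Rightarrow> cell set" where
  "cells b = {(int i, j) | i j. 1 \<le> i \<and> i \<le> length b \<and> 1 \<le> j \<and> j \<le> b ! (i - 1)}"

definition level :: "nat \<Rightarrow> nat \<Rightarrow> nat set" where
  "level m p = {(p - 1) * m + 1 .. p * m}"

definition same_level :: "nat \<Rightarrow> cell \<Rightarrow> cell \<Rightarrow> bool" where
  "same_level m c d \<longleftrightarrow> (\<exists>p\<ge>1. snd c \<in> level m p \<and> snd d \<in> level m p)"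

definition rook_placements :: "nat \<Rightarrow> nat \<Rightarrow> cell set \<Rightarrow> cell set set" where
  "rook_placements k m B =
     {P. P \<subseteq> B \<and> finite P \<and> card P = k \<and>
         (\<forall>c\<in>P. \<forall>d\<in>P. c \<noteq> d \<longrightarrow> fst c \<noteq> fst d \<and> \<not> same_level m c d)}"

definition rook_number :: "nat \<Rightarrow> nat \<Rightarrow> cell set \<Rightarrow> nat" where
  "rook_number k m B = card (rook_placements k m B)"

definition rook_equivalent :: "nat \<Rightarrow> nat list \<Rightarrow> nat list \<Rightarrow> bool" where
  "rook_equivalent m b b' \<longleftrightarrow> (\<forall>k. rook_number k m (cells b) = rook_number k m (cells b'))"

definition Sq :: "nat \<Rightarrow> nat \<Rightarrow> cell set" where
  "Sq N m = {1 .. int N} \<times> {1 .. m * N}"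

text \<open>The translation moving the last column of the board to column \<open>N\<close>.\<close>

definition aligned :: "nat \<Rightarrow> nat list \<Rightarrow> cell set" where
  "aligned N b = (\<lambda>(i, j). (i + int N - int (length b), j)) ` cells b"

definition fits :: "nat \<Rightarrow> nat \<Rightarrow> nat list \<Rightarrow> bool" where
  "fits N m b \<longleftrightarrow> aligned N b \<subseteq> Sq N m"

text \<open>
  The underlying set of the wreath product of the cyclic group of order \<open>m\<close> with the
  symmetric group on \<open>{1..N}\<close>. For a fixed generator \<open>\<alpha>\<close>, each element of the cyclic
  group is \<open>\<alpha> ^ s\<close> for exactly one \<open>s\<close> in \<open>{1..m}\<close> and is represented by this exponent.
\<close>

definition wreath :: "nat \<Rightarrow> nat \<Rightarrow> ((nat \<Rightarrow> nat) \<times> (nat \<Rightarrow> nat)) set" where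
  "wreath m N = ({1..N} \<rightarrow>\<^sub>E {1..m}) \<times> {\<sigma>. \<sigma> permutes {1..N}}"

text \<open>The row of the \<open>t\<close>-th cell from the bottom of level \<open>p\<close>, for \<open>p \<ge> 1\<close> and \<open>1 \<le> t \<le> m\<close>.\<close>

definition level_row :: "nat \<Rightarrow> nat \<Rightarrow> nat \<Rightarrow> nat" where
  "level_row m p t = (p - 1) * m + t"

definition R :: "nat \<Rightarrow> nat \<Rightarrow> (nat \<Rightarrow> nat) \<times> (nat \<Rightarrow> nat) \<Rightarrow> cell set" where
  "R m N = (\<lambda>(s, \<sigma>). {(int i, level_row m (N + 1 - \<sigma> i) (s i)) | i. i \<in> {1..N}})"

definition hit_set :: "nat \<Rightarrow> nat \<Rightarrow> nat \<Rightarrow> nat list \<Rightarrow> cell set set" where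
  "hit_set m k N b = {R m N \<omega> | \<omega>. \<omega> \<in> wreath m N \<and> card (R m N \<omega> \<inter> aligned N b) = k}"

definition hit_number :: "nat \<Rightarrow> nat \<Rightarrow> nat \<Rightarrow> nat list \<Rightarrow> nat" where
  "hit_number m k N b = card (hit_set m k N b)"

end

theory Submission
  imports Defs
begin

text \<open>
  Call a placement of \<open>N\<close> rooks on the square board full; the full placements are exactly the
  \<open>R(\<omega>)\<close>. A placement of \<open>k\<close> rooks on the square extends to \<open>m\<^sup>N\<^sup>-\<^sup>k (N - k)!\<close> full placements,
  whatever its position: filling an empty column leaves \<open>m\<close> choices in each of the unused levels.
  Counting pairs \<open>(P, Q)\<close>, with \<open>P\<close> full and \<open>Q \<subseteq> P \<inter> B\<close> of size \<open>k\<close>, in two ways gives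
  \<open>(\<Sum>j. (j choose k) h\<^sub>j(B)) = m\<^sup>N\<^sup>-\<^sup>k (N - k)! r\<^sub>k(B)\<close>. This triangular system with unit
  diagonal determines the hit numbers from the rook numbers.
\<close>

section \<open>Levels and placements\<close>

text \<open>Numbered from \<open>0\<close>: rows of \<open>level m p\<close> have index \<open>p - 1\<close>.\<close>

definition level_index :: "nat \<Rightarrow> cell \<Rightarrow> nat" where
  "level_index m c = (snd c - 1) div m"

lemma mem_level_iff:
  assumes "m \<ge> 1" "j \<ge> 1" "p \<ge> 1"
  shows "j \<in> level m p \<longleftrightarrow> (j - 1) div m = p - 1"
proof -
  \<comment> \<open>Passing to predecessors removes the truncated subtractions, leaving the usual
    bounds for a quotient.\<close>
  obtain i where i: "j = Suc i" using assms by (cases j) auto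
  obtain q where q: "p = Suc q" using assms by (cases p) auto
  have "i div m = q \<longleftrightarrow> q * m \<le> i \<and> i < Suc q * m"
    using assms div_less_iff_less_mult[of m i "Suc q"] less_eq_div_iff_mult_less_eq[of m q i]
    by (auto simp: less_Suc_eq_le)
  then show ?thesis by (auto simp: i q level_def)
qed

lemma same_level_iff:
  assumes "m \<ge> 1" "snd c \<ge> 1" "snd d \<ge> 1"
  shows "same_level m c d \<longleftrightarrow> level_index m c = level_index m d"
proof
  assume "same_level m c d"
  then show "level_index m c = level_index m d"
    using assms by (auto simp: same_level_def level_index_def mem_level_iff)
next
  assume "level_index m c = level_index m d"
  then show "same_level m c d"
    \<comment> \<open>The successor is needed because \<open>level\<close> numbers from 1 and
      \<open>level_index\<close> from 0.\<close>
    unfolding same_level_def level_index_def using assms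
    by (intro exI[of _ "Suc (level_index m c)"]) (auto simp: mem_level_iff level_index_def)
qed

text \<open>Restates the pairwise non-attacking condition as two injectivity conditions, which pass
  to subsets and control images. The bound on rows matters: row 0 lies in no level, yet
  \<open>level_index\<close> would give it the value 0.\<close>

lemma rook_placements_eq:
  assumes "m \<ge> 1" "\<And>c. c \<in> B \<Longrightarrow> snd c \<ge> 1"
  shows "rook_placements k m B =
    {P. P \<subseteq> B \<and> finite P \<and> card P = k \<and> inj_on fst P \<and> inj_on (level_index m) P}"
proof -
  have *: "(\<forall>c\<in>P. \<forall>d\<in>P. c \<noteq> d \<longrightarrow> fst c \<noteq> fst d \<and> \<not> same_level m c d) \<longleftrightarrow>
      inj_on fst P \<and> inj_on (level_index m) P" if "P \<subseteq> B" for P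
  proof -
    have "same_level m c d \<longleftrightarrow> level_index m c = level_index m d" if "c \<in> P" "d \<in> P" for c d
      using that \<open>P \<subseteq> B\<close> by (intro same_level_iff assms) blast+
    then have "(\<forall>c\<in>P. \<forall>d\<in>P. c \<noteq> d \<longrightarrow> fst c \<noteq> fst d \<and> \<not> same_level m c d) \<longleftrightarrow>
        (\<forall>c\<in>P. \<forall>d\<in>P. c \<noteq> d \<longrightarrow> fst c \<noteq> fst d \<and> level_index m c \<noteq> level_index m d)"
      by (intro ball_cong refl) simp
    also have "\<dots> \<longleftrightarrow> inj_on fst P \<and> inj_on (level_index m) P"
      unfolding inj_on_def by blast
    finally show ?thesis .
  qed
  show ?thesis
    unfolding rook_placements_def by (rule Collect_cong, rule conj_cong[OF refl]) (simp only: *)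
qed

lemma rook_placements_Sq:
  assumes "m \<ge> 1" "A \<subseteq> Sq N m"
  shows "rook_placements k m A =
    {P. P \<subseteq> A \<and> card P = k \<and> inj_on fst P \<and> inj_on (level_index m) P}"
proof -
  have "finite A" using assms(2) by (rule finite_subset) (simp add: Sq_def)
  then show ?thesis
    using assms by (subst rook_placements_eq) (auto simp: Sq_def dest: finite_subset)
qed

lemma finite_rook_placements_Sq:
  assumes "A \<subseteq> Sq N m"
  shows "finite (rook_placements k m A)"
proof (rule finite_subset)
  show "rook_placements k m A \<subseteq> Pow (Sq N m)" using assms by (auto simp: rook_placements_def)
  show "finite (Pow (Sq N m))" by (simp add: Sq_def)
qed

text \<open>Alignment shifts columns injectively and keeps rows, so taking images under it is a
  bijection between the placements on the two boards.\<close>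

lemma rook_number_aligned: "rook_number k m (aligned N b) = rook_number k m (cells b)"
proof -
  define T :: "cell \<Rightarrow> cell" where "T = (\<lambda>(i, j). (i + int N - int (length b), j))"
  have inj: "inj T" by (auto simp: inj_on_def T_def)
  have T: "fst (T c) = fst (T d) \<longleftrightarrow> fst c = fst d" "same_level m (T c) (T d) \<longleftrightarrow> same_level m c d"
    for c d by (auto simp: T_def same_level_def split: prod.splits)
  have mem: "T ` P \<in> rook_placements k m (T ` B) \<longleftrightarrow> P \<in> rook_placements k m B" for P B
    using inj by (auto simp: rook_placements_def T inj_image_subset_iff inj_eq card_image
        finite_image_iff inj_on_subset)
  have "rook_placements k m (T ` cells b) = (`) T ` rook_placements k m (cells b)"
  proof
    show "rook_placements k m (T ` cells b) \<subseteq> (`) T ` rook_placements k m (cells b)"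
    proof
      fix Q assume Q: "Q \<in> rook_placements k m (T ` cells b)"
      then obtain P where "Q = T ` P" by (auto simp: rook_placements_def subset_image_iff)
      then show "Q \<in> (`) T ` rook_placements k m (cells b)" using Q mem by blast
    qed
  qed (use mem in blast)
  moreover have "inj_on ((`) T) (rook_placements k m (cells b))"
    using inj by (auto simp: inj_on_def inj_image_eq_iff)
  ultimately show ?thesis
    by (simp add: rook_number_def aligned_def card_image flip: T_def)
qed

section \<open>Full placements on the square board\<close>

lemma level_index_Sq: "c \<in> Sq N m \<Longrightarrow> level_index m c < N"
  by (auto simp: Sq_def level_index_def less_mult_imp_div_less mult.commute)

text \<open>Pigeonhole: \<open>N\<close> rooks in distinct columns use up all \<open>N\<close>
  columns.\<close>

lemma full_placement_columns:
  assumes "m \<ge> 1" "P \<in> rook_placements N m (Sq N m)"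
  shows "fst ` P = {1..int N}"
proof (rule card_subset_eq)
  show "fst ` P \<subseteq> {1..int N}" using assms by (auto simp: rook_placements_def Sq_def)
  show "card (fst ` P) = card {1..int N}"
    using assms by (simp add: rook_placements_Sq[OF _ order_refl] card_image)
qed simp

lemma R_eq: "R m N (s, \<sigma>) = (\<lambda>i. (int i, (N - \<sigma> i) * m + s i)) ` {1..N}"
  by (auto simp: R_def level_row_def)

lemma R_mem_rook_placements:
  assumes "m \<ge> 1" "\<omega> \<in> wreath m N"
  shows "R m N \<omega> \<in> rook_placements N m (Sq N m)"
proof -
  obtain s \<sigma> where \<omega>: "\<omega> = (s, \<sigma>)" by (cases \<omega>)
  have s: "s i \<ge> 1 \<and> s i \<le> m" if "i \<in> {1..N}" for i
    using assms that by (auto simp: \<omega> wreath_def PiE_iff)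
  have perm: "\<sigma> permutes {1..N}" using assms by (simp add: \<omega> wreath_def)
  have \<sigma>: "\<sigma> i \<ge> 1 \<and> \<sigma> i \<le> N" if "i \<in> {1..N}" for i
    using permutes_in_image[OF perm, of i] that by auto
  let ?f = "\<lambda>i. (int i, (N - \<sigma> i) * m + s i)"
  have row: "(N - \<sigma> i) * m + s i \<le> m * N" if "i \<in> {1..N}" for i
  proof -
    have "(N - \<sigma> i) * m + s i \<le> (N - \<sigma> i) * m + m" using s[OF that] by simp
    also have "\<dots> = Suc (N - \<sigma> i) * m" by simp
    also have "\<dots> \<le> N * m" using \<sigma>[OF that] by (intro mult_le_mono1) auto
    finally show ?thesis by (simp add: mult.commute)
  qed
  have lev: "level_index m (?f i) = N - \<sigma> i" if "i \<in> {1..N}" for i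
  proof -
    \<comment> \<open>As \<open>s i\<close> runs from 1 to \<open>m\<close>, \<open>s i - 1\<close>
      is a remainder modulo \<open>m\<close>, so \<open>N - \<sigma> i\<close> is the
      quotient.\<close>
    have "(N - \<sigma> i) * m + s i - 1 = (s i - 1) + (N - \<sigma> i) * m" "s i - 1 < m"
      using s[OF that] by linarith+
    then show ?thesis using assms(1) by (simp add: level_index_def)
  qed
  have inj: "inj_on ?f {1..N}" by (auto simp: inj_on_def)
  \<comment> \<open>The truncated subtraction loses nothing here, since
    \<open>\<sigma> i \<le> N\<close>.\<close>
  have "inj_on (\<lambda>i. N - \<sigma> i) {1..N}"
  proof (rule inj_onI)
    fix i j assume ij: "i \<in> {1..N}" "j \<in> {1..N}" "N - \<sigma> i = N - \<sigma> j"
    then have "\<sigma> i = \<sigma> j" using \<sigma>[OF ij(1)] \<sigma>[OF ij(2)] by linarith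
    then show "i = j" using permutes_inj[OF perm] by (simp add: inj_eq)
  qed
  also have "?this \<longleftrightarrow> inj_on (level_index m \<circ> ?f) {1..N}"
    by (rule inj_on_cong) (simp only: o_apply lev)
  finally have "inj_on (level_index m) (?f ` {1..N})" by (rule inj_on_imageI)
  moreover have "?f ` {1..N} \<subseteq> Sq N m"
  proof
    fix c assume "c \<in> ?f ` {1..N}"
    then obtain i where i: "i \<in> {1..N}" "c = ?f i" by blast
    show "c \<in> Sq N m" using i(1) s[OF i(1)] row[OF i(1)] unfolding i(2) Sq_def by auto
  qed
  moreover have "inj_on fst (?f ` {1..N})" by (auto simp: inj_on_def)
  moreover have "card (?f ` {1..N}) = N" using inj by (simp add: card_image)
  ultimately show ?thesis
    using assms(1) by (simp add: \<omega> R_eq rook_placements_Sq[OF _ order_refl])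
qed

text \<open>A full placement is the graph of a function \<open>r\<close> from columns to rows.
  Division of \<open>r i - 1\<close> by \<open>m\<close> recovers the pair: the quotient yields
  \<open>\<sigma> i\<close>, the remainder \<open>s i\<close>.\<close>

lemma rook_placement_eq_R:
  assumes m: "m \<ge> 1" and P: "P \<in> rook_placements N m (Sq N m)"
  shows "\<exists>\<omega>\<in>wreath m N. P = R m N \<omega>"
proof -
  have sub: "P \<subseteq> Sq N m" and inj1: "inj_on fst P" and inj2: "inj_on (level_index m) P"
    using P m by (auto simp: rook_placements_Sq[OF _ order_refl])
  have cols: "fst ` P = {1..int N}" by (rule full_placement_columns[OF m P])
  have "\<exists>j. (int i, j) \<in> P" if "i \<in> {1..N}" for i
  proof -
    have "int i \<in> fst ` P" using that cols by auto
    then show ?thesis by force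
  qed
  then obtain r where r: "\<And>i. i \<in> {1..N} \<Longrightarrow> (int i, r i) \<in> P" by metis
  have r1: "r i \<ge> 1" if "i \<in> {1..N}" for i using r[OF that] sub by (auto simp: Sq_def)
  have lev: "(r i - 1) div m < N" if "i \<in> {1..N}" for i
    using level_index_Sq[OF subsetD[OF sub r[OF that]]] by (simp add: level_index_def)
  have P_eq: "P = (\<lambda>i. (int i, r i)) ` {1..N}"
  proof
    show "P \<subseteq> (\<lambda>i. (int i, r i)) ` {1..N}"
    proof
      fix c assume c: "c \<in> P"
      then have "fst c \<in> {1..int N}" using cols by blast
      then have i: "nat (fst c) \<in> {1..N}" "int (nat (fst c)) = fst c" by auto
      then have "c = (int (nat (fst c)), r (nat (fst c)))"
        using inj_onD[OF inj1 _ c r[OF i(1)]] by simp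
      then show "c \<in> (\<lambda>i. (int i, r i)) ` {1..N}" using i(1) by blast
    qed
  qed (use r in auto)
  \<comment> \<open>Off \<open>{1..N}\<close> the values are forced: \<open>permutes\<close> demands
    the identity there, the extensional function space demands \<open>undefined\<close>.\<close>
  define \<sigma> where "\<sigma> i = (if i \<in> {1..N} then N - (r i - 1) div m else i)" for i
  define s where "s = restrict (\<lambda>i. (r i - 1) mod m + 1) {1..N}"
  have "inj_on \<sigma> {1..N}"
  proof (rule inj_onI)
    fix i j assume ij: "i \<in> {1..N}" "j \<in> {1..N}" "\<sigma> i = \<sigma> j"
    then have "(r i - 1) div m = (r j - 1) div m"
      using lev[OF ij(1)] lev[OF ij(2)] unfolding \<sigma>_def by simp
    then have "(int i, r i) = (int j, r j)"
      using inj_onD[OF inj2 _ r[OF ij(1)] r[OF ij(2)]] by (simp add: level_index_def)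
    then show "i = j" by simp
  qed
  \<comment> \<open>An injective self-map of a finite set is onto.\<close>
  moreover have "\<sigma> ` {1..N} \<subseteq> {1..N}" using lev by (force simp: \<sigma>_def Suc_le_eq)
  ultimately have "bij_betw \<sigma> {1..N} {1..N}"
    by (simp add: bij_betw_def endo_inj_surj)
  then have "\<sigma> permutes {1..N}" by (rule bij_imp_permutes) (auto simp: \<sigma>_def)
  moreover have "s \<in> {1..N} \<rightarrow>\<^sub>E {1..m}"
    using m by (auto simp: s_def Suc_le_eq)
  ultimately have "(s, \<sigma>) \<in> wreath m N" by (simp add: wreath_def)
  moreover have "(N - \<sigma> i) * m + s i = r i" if "i \<in> {1..N}" for i
  proof -
    have "N - \<sigma> i = (r i - 1) div m" using that lev[OF that] by (simp add: \<sigma>_def)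
    moreover have "s i = (r i - 1) mod m + 1" using that by (simp add: s_def)
    ultimately have "(N - \<sigma> i) * m + s i = (r i - 1) + 1" by (simp only: add.assoc[symmetric] div_mult_mod_eq)
    then show ?thesis using r1[OF that] by simp
  qed
  then have "P = R m N (s, \<sigma>)" unfolding R_eq P_eq by (intro image_cong) auto
  ultimately show ?thesis by blast
qed

lemma range_R:
  assumes "m \<ge> 1"
  shows "R m N ` wreath m N = rook_placements N m (Sq N m)"
  using R_mem_rook_placements[OF assms] rook_placement_eq_R[OF assms] by blast

section \<open>Extending a placement to a full one\<close>

text \<open>The rows of the square are the disjoint union of \<open>N\<close> levels of
  \<open>m\<close> rows each, so every level outside \<open>L\<close> contributes
  \<open>m\<close>.\<close>

lemma card_rows_outside_levels:
  assumes m: "m \<ge> 1" and L: "L \<subseteq> {..<N}"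
  shows "card {j \<in> {1..m * N}. (j - 1) div m \<notin> L} = m * (N - card L)"
proof -
  have div: "j \<ge> 1 \<Longrightarrow> (j - 1) div m = p \<longleftrightarrow> j \<in> level m (Suc p)" for j p
    using mem_level_iff[OF m, of j "Suc p"] by simp
  have sub: "level m (Suc p) \<subseteq> {1..m * N}" if "p < N" for p
  proof -
    have "Suc p * m \<le> N * m" using that by (intro mult_le_mono1) simp
    then show ?thesis by (auto simp: level_def mult.commute)
  qed
  have "{j \<in> {1..m * N}. (j - 1) div m \<notin> L} = (\<Union>p\<in>{..<N} - L. level m (Suc p))" (is "?A = ?U")
  proof
    show "?A \<subseteq> ?U"
    proof
      fix j assume j: "j \<in> ?A"
      then have "(j - 1) div m < N" by (auto simp: less_mult_imp_div_less mult.commute)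
      then show "j \<in> ?U" using j div[of j "(j - 1) div m"] by auto
    qed
    show "?U \<subseteq> ?A"
    proof
      fix j assume "j \<in> ?U"
      then obtain p where p: "p < N" "p \<notin> L" "j \<in> level m (Suc p)" by auto
      then have "j \<in> {1..m * N}" using sub by blast
      then show "j \<in> ?A" using p div[of j p] by auto
    qed
  qed
  also have "card \<dots> = (\<Sum>p\<in>{..<N} - L. card (level m (Suc p)))"
  proof (intro card_UN_disjoint ballI impI)
    fix p q :: nat assume "p \<noteq> q"
    have "(j - 1) div m = q" if "j \<in> level m (Suc q)" for j q
      using that div[of j q] by (simp add: level_def)
    then show "level m (Suc p) \<inter> level m (Suc q) = {}" using \<open>p \<noteq> q\<close> by (metis disjoint_iff)
  qed (auto simp: level_def)
  also have "\<dots> = m * (N - card L)"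
    using L by (simp add: level_def card_Diff_subset finite_subset mult.commute)
  finally show ?thesis .
qed

text \<open>Induction on the number \<open>d\<close> of missing rooks. Filling one fixed empty
  column with \<open>Suc d\<close> rooks missing offers \<open>m * Suc d\<close> rows, and each
  choice leaves the same problem with \<open>d\<close> missing.\<close>

lemma card_full_extensions:
  assumes m: "m \<ge> 1" and "Q \<in> rook_placements k m (Sq N m)" and "k + d = N"
  shows "card {P \<in> rook_placements N m (Sq N m). Q \<subseteq> P} = m ^ d * fact d"
  using assms(2,3)
proof (induction d arbitrary: Q k)
  case 0
  have "P = Q" if "P \<in> rook_placements N m (Sq N m)" "Q \<subseteq> P" for P
  proof -
    have "finite P" "card Q = card P" using that(1) 0 by (simp_all add: rook_placements_def)
    then show ?thesis using card_subset_eq that(2) by metis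
  qed
  then have "{P \<in> rook_placements N m (Sq N m). Q \<subseteq> P} = {Q}" using 0 by auto
  then show ?case by simp
next
  case (Suc d)
  let ?F = "rook_placements N m (Sq N m)"
  have Q: "Q \<subseteq> Sq N m" "finite Q" "card Q = k" "inj_on fst Q" "inj_on (level_index m) Q"
  proof -
    show "Q \<subseteq> Sq N m" "finite Q" "card Q = k"
      using Suc.prems(1) unfolding rook_placements_def by blast+
    show "inj_on fst Q" "inj_on (level_index m) Q"
      using Suc.prems(1) unfolding rook_placements_Sq[OF m order_refl] by blast+
  qed
  have "card (fst ` Q) < card {1..int N}" using Q Suc.prems by (simp add: card_image)
  then have "\<not> {1..int N} \<subseteq> fst ` Q" using Q(2) card_mono[of "fst ` Q" "{1..int N}"] by force
  then obtain i where i: "i \<in> {1..int N}" "i \<notin> fst ` Q" by blast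
  define J where "J = {j \<in> {1..m * N}. (j - 1) div m \<notin> level_index m ` Q}"
  have iQ: "(i, j) \<notin> Q" for j using i(2) by force
  have card_J: "card J = m * Suc d"
  proof -
    have "level_index m ` Q \<subseteq> {..<N}" using Q level_index_Sq by blast
    then have "card J = m * (N - card (level_index m ` Q))"
      unfolding J_def by (rule card_rows_outside_levels[OF m])
    then show ?thesis using Q Suc.prems by (auto simp: card_image)
  qed
  have J: "insert (i, j) Q \<in> rook_placements (Suc k) m (Sq N m)" if "j \<in> J" for j
  proof -
    have "level_index m (i, j) \<notin> level_index m ` Q" using that by (simp add: J_def level_index_def)
    then have "inj_on (level_index m) (insert (i, j) Q)" using Q by (auto simp: inj_on_insert)
    moreover have "inj_on fst (insert (i, j) Q)" using Q i by (auto simp: inj_on_insert)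
    moreover have "insert (i, j) Q \<subseteq> Sq N m" using Q i that by (auto simp: J_def Sq_def)
    ultimately show ?thesis
      using m Q iQ by (auto simp: rook_placements_Sq[OF _ order_refl])
  qed
  \<comment> \<open>Full extensions are sorted by the row of their rook in column
    \<open>i\<close>.\<close>
  have "{P \<in> ?F. Q \<subseteq> P} = (\<Union>j\<in>J. {P \<in> ?F. insert (i, j) Q \<subseteq> P})"
  proof
    show "{P \<in> ?F. Q \<subseteq> P} \<subseteq> (\<Union>j\<in>J. {P \<in> ?F. insert (i, j) Q \<subseteq> P})"
    proof
      fix P assume P: "P \<in> {P \<in> ?F. Q \<subseteq> P}"
      then have "i \<in> fst ` P" using full_placement_columns[OF m] i(1) by blast
      then obtain j where j: "(i, j) \<in> P" by force
      have "inj_on (level_index m) P" "P \<subseteq> Sq N m"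
        using P m by (auto simp: rook_placements_Sq[OF _ order_refl])
      \<comment> \<open>\<open>P\<close> contains both \<open>Q\<close> and the new rook, so
        injectivity of the level index on \<open>P\<close> keeps that rook out of the levels of
        \<open>Q\<close>.\<close>
      then have "level_index m (i, j) \<notin> level_index m ` Q" "(i, j) \<in> Sq N m"
        using inj_on_image_mem_iff[of "level_index m" P "(i, j)" Q] P j iQ by auto
      then have "j \<in> J" by (simp add: J_def level_index_def Sq_def)
      then show "P \<in> (\<Union>j\<in>J. {P \<in> ?F. insert (i, j) Q \<subseteq> P})" using P j by blast
    qed
  qed blast
  also have "card \<dots> = (\<Sum>j\<in>J. card {P \<in> ?F. insert (i, j) Q \<subseteq> P})"
  proof (intro card_UN_disjoint ballI impI)
    fix j j' :: nat assume "j \<noteq> j'"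
    \<comment> \<open>The classes are disjoint because \<open>P\<close> has only one rook in column
      \<open>i\<close>.\<close>
    have "inj_on fst P" if "P \<in> ?F" for P
      using that m by (simp add: rook_placements_Sq[OF _ order_refl])
    then have "\<not> ((i, j) \<in> P \<and> (i, j') \<in> P)" if "P \<in> ?F" for P
      using that \<open>j \<noteq> j'\<close> inj_onD[of fst P "(i, j)" "(i, j')"] by auto
    then show "{P \<in> ?F. insert (i, j) Q \<subseteq> P} \<inter> {P \<in> ?F. insert (i, j') Q \<subseteq> P} = {}" by blast
  qed (auto simp: J_def finite_rook_placements_Sq[OF order_refl])
  also have "\<dots> = (\<Sum>j\<in>J. m ^ d * fact d)"
    using Suc.IH[OF J] Suc.prems by (intro sum.cong) auto
  also have "\<dots> = m ^ Suc d * fact (Suc d)" using card_J by (simp add: algebra_simps)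
  finally show ?case .
qed

section \<open>Hit numbers from rook numbers\<close>

text \<open>Hit sets consist of placements rather than pairs \<open>(s, \<sigma>)\<close>, so they
  are cut out of the image of \<open>R\<close>.\<close>

lemma hit_number_eq:
  assumes "m \<ge> 1"
  shows "hit_number m k N b =
    card {P \<in> rook_placements N m (Sq N m). card (P \<inter> aligned N b) = k}"
proof -
  have "hit_set m k N b = {P \<in> R m N ` wreath m N. card (P \<inter> aligned N b) = k}"
    unfolding hit_set_def by auto
  then show ?thesis by (simp add: hit_number_def range_R[OF assms])
qed

lemma sum_binomial_hit_number:
  assumes m: "m \<ge> 1" and fits: "fits N m b" and k: "k \<le> N"
  shows "(\<Sum>j\<le>N. (j choose k) * hit_number m j N b) =
    m ^ (N - k) * fact (N - k) * rook_number k m (cells b)"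
proof -
  define A where "A = aligned N b"
  let ?F = "rook_placements N m (Sq N m)" and ?r = "rook_placements k m A"
  have A: "A \<subseteq> Sq N m" using fits by (simp add: A_def fits_def)
  have finF: "finite ?F" by (rule finite_rook_placements_Sq[OF order_refl])
  have F: "finite P \<and> card P = N" if "P \<in> ?F" for P using that by (simp add: rook_placements_def)
  have "(\<Sum>j\<le>N. (j choose k) * hit_number m j N b) =
      (\<Sum>j\<le>N. \<Sum>P\<in>{P \<in> ?F. card (P \<inter> A) = j}. card (P \<inter> A) choose k)"
  proof (rule sum.cong)
    fix j
    have "(\<Sum>P\<in>{P \<in> ?F. card (P \<inter> A) = j}. card (P \<inter> A) choose k) =
        (\<Sum>P\<in>{P \<in> ?F. card (P \<inter> A) = j}. j choose k)" by (rule sum.cong) auto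
    then show "(j choose k) * hit_number m j N b =
        (\<Sum>P\<in>{P \<in> ?F. card (P \<inter> A) = j}. card (P \<inter> A) choose k)"
      by (simp add: hit_number_eq[OF m] A_def)
  qed simp
  \<comment> \<open>The fibres of the hit count partition the full placements.\<close>
  also have "\<dots> = (\<Sum>P\<in>?F. card (P \<inter> A) choose k)"
  proof (rule sum.group[OF finF])
    show "(\<lambda>P. card (P \<inter> A)) ` ?F \<subseteq> {..N}"
    proof (rule image_subsetI)
      fix P assume "P \<in> ?F"
      then show "card (P \<inter> A) \<in> {..N}" using F card_mono[of P "P \<inter> A"] by fastforce
    qed
  qed simp
  \<comment> \<open>The binomial counts \<open>k\<close>-subsets of \<open>P \<inter> A\<close>,
    each of which is a placement because it inherits injectivity from \<open>P\<close>.\<close>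
  also have "\<dots> = (\<Sum>P\<in>?F. card {Q \<in> ?r. Q \<subseteq> P})"
  proof (rule sum.cong)
    fix P assume P: "P \<in> ?F"
    then have "inj_on fst P" "inj_on (level_index m) P"
      using m by (auto simp: rook_placements_Sq[OF _ order_refl])
    then have "{Q \<in> ?r. Q \<subseteq> P} = {Q. Q \<subseteq> P \<inter> A \<and> card Q = k}"
      using rook_placements_Sq[OF m A] by (auto intro: inj_on_subset)
    then show "card (P \<inter> A) choose k = card {Q \<in> ?r. Q \<subseteq> P}"
      using F[OF P] n_subsets[of "P \<inter> A" k] by (metis finite_Int)
  qed simp
  \<comment> \<open>The order of counting is exchanged; every \<open>Q\<close> lies in equally many
    full placements.\<close>
  also have "\<dots> = (\<Sum>Q\<in>?r. m ^ (N - k) * fact (N - k))"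
  proof (rule sum_multicount_gen[OF finF])
    show "finite ?r" using A by (rule finite_rook_placements_Sq)
    have "Q \<in> rook_placements k m (Sq N m)" if "Q \<in> ?r" for Q
      using that A by (auto simp: rook_placements_def)
    then show "\<forall>Q\<in>?r. card {P \<in> ?F. Q \<subseteq> P} = m ^ (N - k) * fact (N - k)"
      using card_full_extensions[OF m _ le_add_diff_inverse[OF k]] by blast
  qed
  also have "\<dots> = m ^ (N - k) * fact (N - k) * rook_number k m (cells b)"
    using rook_number_aligned[of k m N b] by (simp add: rook_number_def A_def)
  finally show ?thesis .
qed

text \<open>Back substitution from \<open>k = N\<close> downwards: in the \<open>k\<close>-th
  equation terms with \<open>j < k\<close> vanish, \<open>j = k\<close> has coefficient 1, and those
  with \<open>j > k\<close> agree by induction.\<close>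

lemma binomial_sums_determine:
  fixes f g :: "nat \<Rightarrow> nat"
  assumes eq: "\<And>k. k \<le> N \<Longrightarrow> (\<Sum>j\<le>N. (j choose k) * f j) = (\<Sum>j\<le>N. (j choose k) * g j)"
    and "k \<le> N"
  shows "f k = g k"
  using \<open>k \<le> N\<close>
proof (induction "N - k" arbitrary: k rule: less_induct)
  case less
  have split: "(\<Sum>j\<le>N. (j choose k) * h j) = h k + (\<Sum>j\<in>{k<..N}. (j choose k) * h j)"
    for h :: "nat \<Rightarrow> nat"
  proof -
    have "(\<Sum>j\<le>N. (j choose k) * h j) = (\<Sum>j\<in>insert k {k<..N}. (j choose k) * h j)"
      using less.prems by (intro sum.mono_neutral_right) (auto simp: not_less)
    then show ?thesis by simp
  qed
  have "(\<Sum>j\<in>{k<..N}. (j choose k) * f j) = (\<Sum>j\<in>{k<..N}. (j choose k) * g j)"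
    using less.hyps by (intro sum.cong) auto
  then show ?case using eq[OF less.prems] by (simp add: split)
qed

theorem corollary25:
  fixes m N k :: nat and b b' :: "nat list"
  assumes "m \<ge> 1"
    and "ferrers_board b" and "ferrers_board b'"
    and "rook_equivalent m b b'"
    and "fits N m b" and "fits N m b'"
    and "k \<le> N"
  shows "hit_number m k N b = hit_number m k N b'"
proof (rule binomial_sums_determine[OF _ \<open>k \<le> N\<close>])
  fix i assume "i \<le> N"
  \<comment> \<open>Both sides are the same multiple of the common rook number for \<open>i\<close>
    rooks.\<close>
  then show "(\<Sum>j\<le>N. (j choose i) * hit_number m j N b) =
      (\<Sum>j\<le>N. (j choose i) * hit_number m j N b')"
    using assms by (simp add: sum_binomial_hit_number rook_equivalent_def)
qed

end
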